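(* Let $p$ be a prime and let $G$ be a non-abelian $p$-group such that $\mathcal{GP}(G)$ is planar. If $p\in\{3,5\}$, then the exponent of $G$ equals $p$. Furthermore (still with $p\in\{3,5\}$), if the order of $G$ is $p^n$, then $\mathcal{GP}(G)$ is a union of $\frac{p^n-1}{p-1}$ connected components, each of which is isomorphic to the complete graph $K_{p-1}$.
   Context: For a group $G$, the generalized power graph $\mathcal{GP}(G)$ is the simple undirected graph whose vertices are the non-identity elements of $G$, two distinct vertices $a,b$ being adjacent if and only if $\langle a\rangle\cap\langle b\rangle\neq 1$. A $p$-group is a (not necessarily finite) group in which every element has order a power of $p$. $K_m$ is the complete graph on $m$ vertices. *)

theory Defs
  imports
    "Graph_Theory.Graph_Theory"
    "HOL-Algebra.Multiplicative_Group"
    "HOL-Algebra.Generated_Groups"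
    "HOL-Analysis.Analysis"
begin

text \<open>
  \<^term>\<open>group.ord G x\<close> is 0 when \<open>x\<close> has infinite order, so such elements are excluded.
\<close>
definition p_group :: "nat \<Rightarrow> ('a, 'b) monoid_scheme \<Rightarrow> bool" where
  "p_group p G \<longleftrightarrow> group G \<and> (\<forall>x \<in> carrier G. \<exists>k. group.ord G x = p ^ k)"

text \<open>The value is 0 if no positive exponent annihilates the group.\<close>
definition group_exponent :: "('a, 'b) monoid_scheme \<Rightarrow> nat" where
  "group_exponent G =
     (if \<exists>n>0. \<forall>x \<in> carrier G. x [^]\<^bsub>G\<^esub> (n::nat) = \<one>\<^bsub>G\<^esub>
      then LEAST n. n > 0 \<and> (\<forall>x \<in> carrier G. x [^]\<^bsub>G\<^esub> n = \<one>\<^bsub>G\<^esub>)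
      else 0)"

text \<open>
  Undirected graphs are symmetric digraphs, as in the AFP entry Graph Theory: an edge \<open>ab\<close>
  is the pair of arcs \<open>(a, b)\<close>, \<open>(b, a)\<close>.
\<close>
definition gen_power_graph :: "('a, 'b) monoid_scheme \<Rightarrow> ('a, 'a \<times> 'a) pre_digraph" where
  "gen_power_graph G = with_proj
     \<lparr> pverts = carrier G - {\<one>\<^bsub>G\<^esub>},
       parcs = {(a, b). a \<in> carrier G - {\<one>\<^bsub>G\<^esub>} \<and> b \<in> carrier G - {\<one>\<^bsub>G\<^esub>} \<and> a \<noteq> b \<and>
                 generate G {a} \<inter> generate G {b} \<noteq> {\<one>\<^bsub>G\<^esub>}} \<rparr>"

definition undirected_edges :: "('a, 'b) pre_digraph \<Rightarrow> 'a set set" where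
  "undirected_edges G = {{u, v} | u v. (u, v) \<in> arcs_ends G}"

text \<open>
  A simple graph, finite or not, is planar if it has a drawing in the plane (here the complex
  plane) without crossings: \<open>\<phi>\<close> places the vertices, \<open>\<gamma>\<close> draws every edge as a simple arc
  joining its two ends, and an arc meets the vertices and the other arcs only in common ends.
\<close>
definition planar :: "('a, 'b) pre_digraph \<Rightarrow> bool" where
  "planar G \<longleftrightarrow>
     (\<exists>(\<phi> :: 'a \<Rightarrow> complex) (\<gamma> :: 'a set \<Rightarrow> real \<Rightarrow> complex).
        inj_on \<phi> (verts G) \<and>
        (\<forall>e \<in> undirected_edges G.
           Path_Connected.arc (\<gamma> e) \<and>
           {pathstart (\<gamma> e), pathfinish (\<gamma> e)} = \<phi> ` e \<and>
           path_image (\<gamma> e) \<inter> \<phi> ` verts G = \<phi> ` e) \<and>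
        (\<forall>e \<in> undirected_edges G. \<forall>f \<in> undirected_edges G. e \<noteq> f \<longrightarrow>
           path_image (\<gamma> e) \<inter> path_image (\<gamma> f) = \<phi> ` (e \<inter> f)))"

text \<open>
  In a symmetric digraph reachability is symmetric, so the strongly connected components are the
  connected components of the undirected graph.
\<close>
abbreviation graph_components :: "('a, 'b) pre_digraph \<Rightarrow> ('a, 'b) pre_digraph set" where
  "graph_components \<equiv> pre_digraph.sccs"

end

theory Submission
  imports Defs
begin

text \<open>
  If \<open>x\<close> had order at least \<open>p\<^sup>2 \<ge> 9\<close>, then \<open>x\<close>, \<open>x\<^sup>2\<close>, \<open>x\<^sup>4\<close>, \<open>x\<^sup>7\<close>, \<open>x\<^sup>8\<close> would be five distinct
  generators of \<open>\<langle>x\<rangle>\<close>, so the graph would contain \<open>K\<^sub>5\<close>, which is not planar.  Hence every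
  non-identity element has order \<open>p\<close>, adjacency means generating the same subgroup, and the
  components are the sets \<open>\<langle>a\<rangle> - {1}\<close>.

  That \<open>K\<^sub>5\<close> has no plane drawing is derived from the Jordan curve theorem and Janiszewski's
  theorem.  In such a drawing no vertex lies inside a triangle.  Therefore, of the three paths
  \<open>ab\<close>, \<open>acb\<close>, \<open>adb\<close>, only the edge \<open>ab\<close> can lie inside the cycle formed by the other two, and
  likewise \<open>cd\<close> lies inside the same 4-cycle.
\<close>

section \<open>Theta curves\<close>

text \<open>Only the image of the path is kept, so that edges and their unions can be handled as
  point sets, without orientation or parametrization.\<close>

definition arc_joining :: "complex set \<Rightarrow> complex \<Rightarrow> complex \<Rightarrow> bool" where
  "arc_joining A a b \<longleftrightarrow>
     (\<exists>g. Path_Connected.arc g \<and> pathstart g = a \<and> pathfinish g = b \<and> path_image g = A)"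

lemma arc_joiningE:
  assumes "arc_joining A a b"
  obtains g where "Path_Connected.arc g" "pathstart g = a" "pathfinish g = b" "path_image g = A"
  using assms unfolding arc_joining_def by blast

lemma arc_joining_sym: "arc_joining A a b \<Longrightarrow> arc_joining A b a"
  unfolding arc_joining_def
  by (metis arc_reversepath path_image_reversepath pathfinish_reversepath pathstart_reversepath)

lemma arc_joining_Un:
  assumes "arc_joining A a b" "arc_joining B b c" "A \<inter> B = {b}"
  shows "arc_joining (A \<union> B) a c"
proof -
  obtain g where g: "Path_Connected.arc g" "pathstart g = a" "pathfinish g = b" "path_image g = A"
    using assms(1) by (rule arc_joiningE)
  obtain h where h: "Path_Connected.arc h" "pathstart h = b" "pathfinish h = c" "path_image h = B"
    using assms(2) by (rule arc_joiningE)
  show ?thesis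
    unfolding arc_joining_def using assms(3) g h
    by (intro exI[of _ "g +++ h"]) (auto simp: arc_join path_image_join)
qed

text \<open>Since the path is injective, deleting an end of the arc amounts to deleting an end of
  the parameter interval, which stays connected. The pieces left over are what can avoid a curve
  passing through the deleted ends.\<close>

lemma arc_joining_props:
  assumes "arc_joining A a b"
  shows "a \<in> A" "b \<in> A" "a \<noteq> b" "compact A" "Topological_Spaces.connected A" "Topological_Spaces.connected (A - {a})"
    "Topological_Spaces.connected (A - {b})" "Topological_Spaces.connected (A - {a, b})" "A - {a, b} \<noteq> {}"
proof -
  obtain g where g: "Path_Connected.arc g" "pathstart g = a" "pathfinish g = b" "path_image g = A"
    using assms by (rule arc_joiningE)
  show "a \<in> A" "b \<in> A" "a \<noteq> b" "compact A" "Topological_Spaces.connected A"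
    using g arc_distinct_ends arc_imp_path
    by (blast intro: pathstart_in_path_image pathfinish_in_path_image compact_path_image connected_path_image)+
  have inj: "inj_on g {0..1}" and cont: "continuous_on {0..1} g"
    using g(1) by (auto simp: Path_Connected.arc_def path_def)
  have A: "A = g ` {0..1}" and a: "a = g 0" and b: "b = g 1"
    using g by (auto simp: path_image_def pathstart_def pathfinish_def)
  have "{0<..1} = {0..1} - {0::real}" "{0..<1} = {0..1} - {1::real}" by auto
  then have "A - {a} = g ` {0<..1}" "A - {b} = g ` {0..<1}"
    unfolding A a b using inj by (simp_all add: inj_on_image_set_diff[of g "{0..1}"])
  moreover have "Topological_Spaces.connected (g ` {0<..1})" "Topological_Spaces.connected (g ` {0..<1})"
    by (auto intro!: connected_continuous_image continuous_on_subset[OF cont])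
  ultimately show "Topological_Spaces.connected (A - {a})" "Topological_Spaces.connected (A - {b})" by simp_all
  show "Topological_Spaces.connected (A - {a, b})" "A - {a, b} \<noteq> {}"
    using connected_simple_path_endless[of g] nonempty_simple_path_endless[of g]
      arc_imp_simple_path[OF g(1)] g by simp_all
qed

text \<open>\<open>X\<close> lies in one component of the complement of \<open>S\<close>, and
  \<open>inside S\<close> is a union of such components.\<close>

lemma connected_meets_inside:
  assumes "Topological_Spaces.connected X" "X \<inter> S = {}" "x \<in> X" "x \<in> inside S" "y \<in> X"
  shows "y \<in> inside S"
  using assms inside_same_component[of S x y]
  by (meson ComplI connected_component_of_subset connected_component_def disjoint_iff subsetI)

lemma Jordan_two_arcs:
  assumes "arc_joining A a b" "arc_joining B a b" "A \<inter> B = {a, b}"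
  shows "inside (A \<union> B) \<noteq> {}" "Topological_Spaces.connected (inside (A \<union> B))" "Topological_Spaces.connected (outside (A \<union> B))"
    "frontier (inside (A \<union> B)) = A \<union> B"
proof -
  obtain g where g: "Path_Connected.arc g" "pathstart g = a" "pathfinish g = b" "path_image g = A"
    using assms(1) by (rule arc_joiningE)
  \<comment> \<open>The second arc is run backwards, from \<open>b\<close> to \<open>a\<close>, so
    that \<open>g +++ h\<close> is a loop.\<close>
  obtain h where h: "Path_Connected.arc h" "pathstart h = b" "pathfinish h = a" "path_image h = B"
    using arc_joining_sym[OF assms(2)] by (rule arc_joiningE)
  have "simple_path (g +++ h)" "pathfinish (g +++ h) = pathstart (g +++ h)"
    "path_image (g +++ h) = A \<union> B"
    using assms(3) g h by (auto simp: simple_path_join_loop_eq path_image_join)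
  then show "inside (A \<union> B) \<noteq> {}" "Topological_Spaces.connected (inside (A \<union> B))" "Topological_Spaces.connected (outside (A \<union> B))"
    "frontier (inside (A \<union> B)) = A \<union> B"
    using Jordan_inside_outside[of "g +++ h"] by simp_all
qed

text \<open>The chord theorem \<open>split_inside_simple_closed_curve\<close>, restated for arcs
  given as point sets.\<close>

lemma theta_split_inside:
  assumes "arc_joining A a b" "arc_joining B a b" "arc_joining C a b"
    and "A \<inter> B = {a, b}" "A \<inter> C = {a, b}" "B \<inter> C = {a, b}"
    and "C \<inter> inside (A \<union> B) \<noteq> {}"
  shows "inside (A \<union> C) \<union> inside (B \<union> C) \<union> (C - {a, b}) = inside (A \<union> B)"
proof -
  obtain f where f: "Path_Connected.arc f" "pathstart f = a" "pathfinish f = b" "path_image f = A"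
    using assms(1) by (rule arc_joiningE)
  obtain g where g: "Path_Connected.arc g" "pathstart g = a" "pathfinish g = b" "path_image g = B"
    using assms(2) by (rule arc_joiningE)
  obtain h where h: "Path_Connected.arc h" "pathstart h = a" "pathfinish h = b" "path_image h = C"
    using assms(3) by (rule arc_joiningE)
  have "inside (path_image f \<union> path_image h) \<union> inside (path_image g \<union> path_image h) \<union>
      (path_image h - {a, b}) = inside (path_image f \<union> path_image g)"
    by (rule split_inside_simple_closed_curve[of f a b g h])
       (use assms(4-) arc_joining_props(3)[OF assms(1)] f g h in
         \<open>simp_all add: arc_imp_simple_path\<close>)
  then show ?thesis by (simp only: f g h)
qed

text \<open>
  Otherwise a point inside \<open>B \<union> C\<close> could be joined to infinity both off \<open>A \<union> B\<close> (through \<open>C\<close>)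
  and off \<open>A \<union> C\<close> (through \<open>B\<close>); as these two sets meet in the connected set \<open>A\<close>,
  Janiszewski's theorem joins it to infinity off their union.
\<close>
lemma theta_some_arc_inside:
  assumes A: "arc_joining A a b" and B: "arc_joining B a b" and C: "arc_joining C a b"
    and AB: "A \<inter> B = {a, b}" and AC: "A \<inter> C = {a, b}" and BC: "B \<inter> C = {a, b}"
  shows "A \<inter> inside (B \<union> C) \<noteq> {} \<or> B \<inter> inside (A \<union> C) \<noteq> {} \<or> C \<inter> inside (A \<union> B) \<noteq> {}"
proof (rule ccontr)
  assume none: "\<not> ?thesis"
  have cpt: "compact A" "compact B" "compact C"
    using A B C arc_joining_props(4) by blast+
  obtain w where w: "w \<in> inside (B \<union> C)"
    using Jordan_two_arcs(1)[OF B C BC] by blast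
  have "outside (A \<union> B \<union> C) \<noteq> {}"
    using cpt by (intro outside_bounded_nonempty compact_imp_bounded compact_Un)
  then obtain z where z: "z \<in> outside (A \<union> B \<union> C)" by blast
  \<comment> \<open>Used with \<open>(X, Y)\<close> equal to \<open>(B, C)\<close> and to
    \<open>(C, B)\<close>.\<close>
  have sep: "connected_component (- (A \<union> X)) w z"
    if X: "arc_joining X a b" and Y: "arc_joining Y a b" and XY: "X \<inter> Y = {a, b}"
      and AX: "A \<inter> X = {a, b}" and AY: "A \<inter> Y = {a, b}"
      and BCXY: "B \<union> C = X \<union> Y" and Yin: "Y \<inter> inside (A \<union> X) = {}" for X Y
  proof -
    \<comment> \<open>\<open>?N\<close> is connected because it lies between a connected set and its
      closure, and it misses \<open>A \<union> X\<close>. So \<open>w\<close> is on the same side of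
      \<open>A \<union> X\<close> as the open arc \<open>Y - {a, b}\<close>, which is not the
      inside.\<close>
    let ?N = "inside (X \<union> Y) \<union> (Y - {a, b})"
    have "closure (inside (X \<union> Y)) = inside (X \<union> Y) \<union> (X \<union> Y)"
      using Jordan_two_arcs(4)[OF X Y XY] by (simp add: closure_Un_frontier)
    then have conn: "Topological_Spaces.connected ?N"
      by (intro connected_intermediate_closure[OF Jordan_two_arcs(2)[OF X Y XY]]) auto
    have disj: "?N \<inter> (A \<union> X) = {}"
    proof -
      have "A \<inter> inside (X \<union> Y) = {}" using none BCXY by simp
      moreover have "inside (X \<union> Y) \<inter> X = {}" using inside_no_overlap[of "X \<union> Y"] by fast
      ultimately show ?thesis using XY AY by fast
    qed
    obtain y where y: "y \<in> Y - {a, b}" using arc_joining_props(9)[OF Y] by blast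
    have "w \<notin> inside (A \<union> X)"
      proof
      assume "w \<in> inside (A \<union> X)"
      then have "y \<in> inside (A \<union> X)"
        using connected_meets_inside[OF conn disj, of w y] w y BCXY by simp
      then show False using y Yin by fast
    qed
    moreover have "w \<notin> A \<union> X" using disj w BCXY by (metis Int_iff Un_iff empty_iff)
    ultimately have "w \<in> outside (A \<union> X)"
      using inside_Un_outside[of "A \<union> X"] by (metis ComplI Un_iff)
    moreover have "z \<in> outside (A \<union> X)"
    proof -
      have "A \<union> X \<subseteq> A \<union> B \<union> C" using BCXY by blast
      then show ?thesis using z outside_mono[of "A \<union> X" "A \<union> B \<union> C"] by fast
    qed
    moreover have "outside (A \<union> X) \<subseteq> - (A \<union> X)"
      using outside_no_overlap[of "A \<union> X"] by (simp only: disjoint_eq_subset_Compl)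
    ultimately show ?thesis
      using Jordan_two_arcs(3)[OF A X AX] unfolding connected_component_def by meson
  qed
  have "connected_component (- (A \<union> B)) w z"
    using none by (intro sep[OF B C BC AB AC]) simp_all
  moreover have "connected_component (- (A \<union> C)) w z"
    using none BC by (intro sep[OF C B _ AC AB]) (simp_all add: Int_commute Un_commute)
  moreover have "(A \<union> B) \<inter> (A \<union> C) = A" using AB AC BC by auto
  then have "Topological_Spaces.connected ((A \<union> B) \<inter> (A \<union> C))"
    using arc_joining_props(5)[OF A] by simp
  moreover have "compact (A \<union> B)" "closed (A \<union> C)"
    using cpt by (simp_all add: compact_Un compact_imp_closed)
  ultimately have "connected_component (- ((A \<union> B) \<union> (A \<union> C))) w z"
    using Janiszewski by blast
  then have "connected_component (- (B \<union> C)) w z"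
    by (rule connected_component_of_subset) auto
  then have "z \<in> inside (B \<union> C)" using w inside_same_component by metis
  moreover have "outside (A \<union> B \<union> C) \<subseteq> outside (B \<union> C)"
    by (rule outside_mono) fast
  ultimately show False using z inside_Int_outside[of "B \<union> C"] by fast
qed

section \<open>Plane drawings of complete graphs\<close>

text \<open>Vertices are identified with their points in the plane, and an edge is indexed by the
  unordered pair of its ends.\<close>

locale complete_plane_drawing =
  fixes V :: "complex set" and E :: "complex set \<Rightarrow> complex set"
  assumes edge_arc: "\<lbrakk>x \<in> V; y \<in> V; x \<noteq> y\<rbrakk> \<Longrightarrow> arc_joining (E {x, y}) x y"
    and edge_vertices: "\<lbrakk>x \<in> V; y \<in> V; x \<noteq> y\<rbrakk> \<Longrightarrow> E {x, y} \<inter> V = {x, y}"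
    and edge_Int: "\<lbrakk>x \<in> V; y \<in> V; x \<noteq> y; z \<in> V; w \<in> V; z \<noteq> w; {x, y} \<noteq> {z, w}\<rbrakk>
      \<Longrightarrow> E {x, y} \<inter> E {z, w} = {x, y} \<inter> {z, w}"
begin

section \<open>Edges and triangles\<close>

lemma vertex_in_edge:
  "\<lbrakk>x \<in> V; y \<in> V; x \<noteq> y; z \<in> V\<rbrakk> \<Longrightarrow> z \<in> E {x, y} \<longleftrightarrow> z = x \<or> z = y"
  using edge_vertices[of x y] by (metis Int_iff insert_iff singletonD)

definition triangle :: "complex \<Rightarrow> complex \<Rightarrow> complex \<Rightarrow> complex set" where
  "triangle x y z = E {x, y} \<union> E {y, z} \<union> E {x, z}"

lemma disjoint_edges:
  "\<lbrakk>{x, y, z, w} \<subseteq> V; distinct [x, y, z, w]\<rbrakk> \<Longrightarrow> E {x, y} \<inter> E {z, w} = {}"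
  by (subst edge_Int) (auto simp: doubleton_eq_iff)

lemma adjacent_edges:
  "\<lbrakk>{x, y, z} \<subseteq> V; distinct [x, y, z]\<rbrakk> \<Longrightarrow> E {x, y} \<inter> E {x, z} = {x}"
  by (subst edge_Int) (auto simp: doubleton_eq_iff)

lemma edge_Int_triangle:
  assumes "{x, y, z, w} \<subseteq> V" "distinct [x, y, z, w]"
  shows "E {w, z} \<inter> triangle x y z = {z}"
proof -
  have "E {w, z} \<inter> E {x, y} = {}" using assms by (intro disjoint_edges) auto
  moreover have "E {w, z} \<inter> E {y, z} = {z}" "E {w, z} \<inter> E {x, z} = {z}"
    using adjacent_edges[of z w y] adjacent_edges[of z w x] assms
    by (auto simp: insert_commute)
  ultimately show ?thesis unfolding triangle_def by fast
qed

lemma edge_disjoint_triangle: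
  assumes "{x, y, z, w, u} \<subseteq> V" "distinct [x, y, z, w, u]"
  shows "E {w, u} \<inter> triangle x y z = {}"
proof -
  have "E {w, u} \<inter> E {x, y} = {}" "E {w, u} \<inter> E {y, z} = {}" "E {w, u} \<inter> E {x, z} = {}"
    using assms by (intro disjoint_edges; auto)+
  then show ?thesis unfolding triangle_def by fast
qed

text \<open>The edge meets the triangle only in \<open>z\<close>; without \<open>z\<close> it is a
  connected set off the triangle that contains both \<open>q\<close> and \<open>w\<close>.\<close>

lemma vertex_outside_triangle_edge:
  assumes "{x, y, z, w} \<subseteq> V" "distinct [x, y, z, w]"
    and "q \<in> E {w, z}" "q \<noteq> z" "q \<in> inside (triangle x y z)"
  shows "w \<in> inside (triangle x y z)"
proof (rule connected_meets_inside[of "E {w, z} - {z}" _ q])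
  have arc: "arc_joining (E {w, z}) w z" using assms by (auto intro: edge_arc)
  show "Topological_Spaces.connected (E {w, z} - {z})" "w \<in> E {w, z} - {z}"
    using arc_joining_props[OF arc] by auto
  show "(E {w, z} - {z}) \<inter> triangle x y z = {}"
    using edge_Int_triangle[OF assms(1,2)] by fast
qed (use assms in auto)

text \<open>The edge \<open>wu\<close> shares no end with the triangle, so it joins \<open>w\<close>
  to \<open>u\<close> without meeting it.\<close>

lemma same_side_of_triangle:
  assumes "{x, y, z, w, u} \<subseteq> V" "distinct [x, y, z, w, u]" "w \<in> inside (triangle x y z)"
  shows "u \<in> inside (triangle x y z)"
proof (rule connected_meets_inside[of "E {w, u}" _ w])
  have arc: "arc_joining (E {w, u}) w u" using assms by (auto intro: edge_arc)
  show "Topological_Spaces.connected (E {w, u})" "w \<in> E {w, u}" "u \<in> E {w, u}"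
    using arc_joining_props[OF arc] by auto
  show "E {w, u} \<inter> triangle x y z = {}"
    using assms(1,2) by (rule edge_disjoint_triangle)
qed (use assms in auto)

lemma vertex_notin_inside_triangle:
  assumes "{x, y, z} \<subseteq> V" "distinct [x, y, z]" "v \<in> {x, y, z}"
  shows "v \<notin> inside (triangle x y z)"
proof -
  have "v \<in> triangle x y z"
    using assms by (auto simp: triangle_def vertex_in_edge)
  then show ?thesis using inside_no_overlap[of "triangle x y z"] by fast
qed

section \<open>Two-edge paths and 4-cycles\<close>

text \<open>The middle vertex is the second argument. The edge \<open>xy\<close> and two such paths
  from \<open>x\<close> to \<open>y\<close> form a theta curve.\<close>

definition two_path :: "complex \<Rightarrow> complex \<Rightarrow> complex \<Rightarrow> complex set" where
  "two_path x z y = E {x, z} \<union> E {z, y}"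

lemma two_path_arc:
  assumes "{x, y, z} \<subseteq> V" "distinct [x, y, z]"
  shows "arc_joining (two_path x z y) x y"
  unfolding two_path_def
proof (rule arc_joining_Un)
  show "E {x, z} \<inter> E {z, y} = {z}"
    using adjacent_edges[of z x y] assms by (auto simp: insert_commute)
qed (use assms in \<open>auto intro: edge_arc\<close>)

lemma vertex_in_two_path:
  assumes "{x, y, z} \<subseteq> V" "distinct [x, y, z]" "v \<in> V"
  shows "v \<in> two_path x z y \<longleftrightarrow> v \<in> {x, y, z}"
  using assms by (auto simp: two_path_def vertex_in_edge)

lemma edge_two_path:
  assumes "{x, y, z} \<subseteq> V" "distinct [x, y, z]"
  shows "E {x, y} \<inter> two_path x z y = {x, y}" "E {x, y} \<union> two_path x z y = triangle x y z"
proof -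
  have "E {x, y} \<inter> E {x, z} = {x}" "E {x, y} \<inter> E {z, y} = {y}"
    using adjacent_edges[of x y z] adjacent_edges[of y x z] assms by (auto simp: insert_commute)
  then show "E {x, y} \<inter> two_path x z y = {x, y}" unfolding two_path_def by fast
  show "E {x, y} \<union> two_path x z y = triangle x y z"
    unfolding two_path_def triangle_def by (auto simp: insert_commute)
qed

lemma two_path_Int:
  assumes "{x, y, z, w} \<subseteq> V" "distinct [x, y, z, w]"
  shows "two_path x z y \<inter> two_path x w y = {x, y}"
proof -
  have "E {x, z} \<inter> E {x, w} = {x}" "E {z, y} \<inter> E {w, y} = {y}"
    "E {x, z} \<inter> E {w, y} = {}" "E {z, y} \<inter> E {x, w} = {}"
    using adjacent_edges[of x z w] adjacent_edges[of y z w] disjoint_edges[of x z w y]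
      disjoint_edges[of z y x w] assms by (auto simp: insert_commute)
  then show ?thesis unfolding two_path_def by fast
qed

text \<open>This is the 4-cycle \<open>xzyw\<close>: the arguments list its two pairs of opposite
  vertices, so \<open>xy\<close> and \<open>zw\<close> are its diagonals.\<close>

definition quad :: "complex \<Rightarrow> complex \<Rightarrow> complex \<Rightarrow> complex \<Rightarrow> complex set" where
  "quad x y z w = two_path x z y \<union> two_path x w y"

lemma quad_swap: "quad z w x y = quad x y z w"
  unfolding quad_def two_path_def by (auto simp: insert_commute)

text \<open>The theta curve of \<open>xy\<close>, \<open>xzy\<close> and \<open>xwy\<close>, with
  the edge \<open>xy\<close> as the chord.\<close>

lemma quad_split_by_edge:
  assumes V: "{x, y, z, w} \<subseteq> V" "distinct [x, y, z, w]"
    and meets: "E {x, y} \<inter> inside (quad x y z w) \<noteq> {}"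
  shows "inside (triangle x y z) \<union> inside (triangle x y w) \<union> (E {x, y} - {x, y}) =
    inside (quad x y z w)"
proof -
  have z: "E {x, y} \<inter> two_path x z y = {x, y}" "E {x, y} \<union> two_path x z y = triangle x y z"
    using edge_two_path[of x y z] V by auto
  have w: "E {x, y} \<inter> two_path x w y = {x, y}" "E {x, y} \<union> two_path x w y = triangle x y w"
    using edge_two_path[of x y w] V by auto
  have "inside (two_path x z y \<union> E {x, y}) \<union> inside (two_path x w y \<union> E {x, y}) \<union>
      (E {x, y} - {x, y}) = inside (two_path x z y \<union> two_path x w y)"
  proof (rule theta_split_inside)
    show "arc_joining (two_path x z y) x y" "arc_joining (two_path x w y) x y"
      "arc_joining (E {x, y}) x y"
      using two_path_arc[of x y z] two_path_arc[of x y w] edge_arc[of x y] V by auto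
    show "two_path x z y \<inter> two_path x w y = {x, y}"
      using V by (rule two_path_Int)
  qed (use z w meets in \<open>simp_all add: Int_commute quad_def\<close>)
  then show ?thesis using z(2) w(2) by (simp add: quad_def Un_commute)
qed

text \<open>The same theta curve, now with the path \<open>xwy\<close> as the chord; it enters the
  triangle because it contains \<open>w\<close>.\<close>

lemma triangle_split_by_two_path:
  assumes V: "{x, y, z, w} \<subseteq> V" "distinct [x, y, z, w]"
    and "w \<in> inside (triangle x y z)"
  shows "inside (triangle x y w) \<union> inside (quad x y z w) \<union> (two_path x w y - {x, y}) =
    inside (triangle x y z)"
proof -
  have z: "E {x, y} \<inter> two_path x z y = {x, y}" "E {x, y} \<union> two_path x z y = triangle x y z"
    using edge_two_path[of x y z] V by auto
  have w: "E {x, y} \<inter> two_path x w y = {x, y}" "E {x, y} \<union> two_path x w y = triangle x y w"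
    using edge_two_path[of x y w] V by auto
  have "inside (E {x, y} \<union> two_path x w y) \<union> inside (two_path x z y \<union> two_path x w y) \<union>
      (two_path x w y - {x, y}) = inside (E {x, y} \<union> two_path x z y)"
  proof (rule theta_split_inside)
    show "arc_joining (two_path x z y) x y" "arc_joining (two_path x w y) x y"
      "arc_joining (E {x, y}) x y"
      using two_path_arc[of x y z] two_path_arc[of x y w] edge_arc[of x y] V by auto
    show "two_path x z y \<inter> two_path x w y = {x, y}"
      using V by (rule two_path_Int)
    have "w \<in> two_path x w y" using vertex_in_two_path[of x y w w] V by auto
    then show "two_path x w y \<inter> inside (E {x, y} \<union> two_path x z y) \<noteq> {}"
      using assms(3) z(2) by auto
  qed (use z(1) w(1) in simp_all)
  then show ?thesis using z(2) w(2) by (simp add: quad_def)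
qed

text \<open>
  If \<open>d\<close>, hence also \<open>e\<close>, were inside \<open>abc\<close>, the path \<open>adb\<close> and the edge \<open>cd\<close> would cut the
  interior of \<open>abc\<close> into the interiors of \<open>abd\<close>, \<open>acd\<close>, \<open>bcd\<close>.  Whichever contains \<open>e\<close> also
  contains the remaining vertex of \<open>abc\<close>, to which \<open>e\<close> is joined by an edge.
\<close>
lemma no_vertex_inside_triangle:
  assumes V: "{a, b, c, d, e} \<subseteq> V" and dist: "distinct [a, b, c, d, e]"
  shows "d \<notin> inside (triangle a b c)"
proof
  assume d: "d \<in> inside (triangle a b c)"
  then have e: "e \<in> inside (triangle a b c)"
    using same_side_of_triangle[of a b c d e] V dist by simp
  have split: "inside (triangle a b d) \<union> inside (quad a b c d) \<union> (two_path a d b - {a, b}) =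
      inside (triangle a b c)"
    using triangle_split_by_two_path[of a b c d] V dist d by auto
  have "e \<notin> two_path a d b"
    using vertex_in_two_path[of a b d e] V dist by auto
  moreover have "e \<notin> inside (triangle a b d)"
  proof
    assume "e \<in> inside (triangle a b d)"
    then have "c \<in> inside (triangle a b d)"
      using same_side_of_triangle[of a b d e c] V dist by auto
    then have "c \<in> inside (triangle a b c)" using split by blast
    then show False using vertex_notin_inside_triangle[of a b c c] V dist by simp
  qed
  ultimately have e_quad: "e \<in> inside (quad a b c d)" using split e by blast
  \<comment> \<open>A point \<open>q\<close> of the edge \<open>cd\<close> other than its ends is
    tracked in order to show that this edge enters the 4-cycle, as \<open>quad_split_by_edge\<close>
    requires.\<close>
  have cd: "arc_joining (E {c, d}) c d" using V dist by (auto intro: edge_arc)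
  then obtain q where q: "q \<in> E {c, d}" "q \<noteq> c" "q \<noteq> d"
    using arc_joining_props(9) by blast
  have "q \<in> inside (triangle a b c)"
  proof (rule connected_meets_inside[of "E {c, d} - {c}" _ d])
    show "(E {c, d} - {c}) \<inter> triangle a b c = {}"
      using edge_Int_triangle[of a b c d] V dist by (auto simp: insert_commute)
  qed (use arc_joining_props[OF cd] q d in auto)
  moreover have "q \<notin> inside (triangle a b d)"
  proof
    assume "q \<in> inside (triangle a b d)"
    then have "c \<in> inside (triangle a b d)"
      using vertex_outside_triangle_edge[of a b d c q] V dist q by auto
    then have "c \<in> inside (triangle a b c)" using split by blast
    then show False using vertex_notin_inside_triangle[of a b c c] V dist by simp
  qed
  moreover have "q \<notin> two_path a d b"
  proof -
    have "E {c, d} \<inter> E {a, d} = {d}" "E {c, d} \<inter> E {d, b} = {d}"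
      using adjacent_edges[of d c a] adjacent_edges[of d c b] V dist
      by (auto simp: insert_commute)
    then show ?thesis using q unfolding two_path_def by fast
  qed
  ultimately have q_quad: "q \<in> inside (quad c d a b)" using split quad_swap[of c d a b] by auto
  have split': "inside (triangle c d a) \<union> inside (triangle c d b) \<union> (E {c, d} - {c, d}) =
      inside (quad c d a b)"
    using quad_split_by_edge[of c d a b] V dist q(1) q_quad by auto
  moreover have "e \<notin> E {c, d}" using V dist by (auto simp: vertex_in_edge)
  ultimately have "e \<in> inside (triangle c d a) \<or> e \<in> inside (triangle c d b)"
    using e_quad quad_swap[of c d a b] by auto
  \<comment> \<open>If \<open>e\<close> is inside \<open>cda\<close>, then so is \<open>b\<close>;
    if it is inside \<open>cdb\<close>, then so is \<open>a\<close>. Either would put a vertex of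
    the 4-cycle into its own interior.\<close>
  moreover have "v \<notin> inside (quad c d a b)" if "v \<in> {a, b}" for v
  proof -
    have "v \<in> quad c d a b"
      using vertex_in_two_path[of c d a v] vertex_in_two_path[of c d b v] V dist that
      by (auto simp: quad_def)
    then show ?thesis using inside_no_overlap[of "quad c d a b"] by fast
  qed
  ultimately show False
    using same_side_of_triangle[of c d a e b] same_side_of_triangle[of c d b e a]
      split' V dist by auto
qed

lemma edge_inside_quad:
  assumes V: "{a, b, c, d, e} \<subseteq> V" and dist: "distinct [a, b, c, d, e]"
  shows "E {a, b} \<inter> inside (quad a b c d) \<noteq> {}"
proof (rule ccontr)
  assume none: "\<not> ?thesis"
  let ?C = "two_path a c b" and ?D = "two_path a d b"
  have arcs: "arc_joining (E {a, b}) a b" "arc_joining ?C a b" "arc_joining ?D a b"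
    using edge_arc[of a b] two_path_arc[of a b c] two_path_arc[of a b d] V dist by auto
  note ab_c = edge_two_path[of a b c] and ab_d = edge_two_path[of a b d]
  note cd = two_path_Int[of a b c d]
  have "?C \<inter> inside (triangle a b d) \<noteq> {} \<or> ?D \<inter> inside (triangle a b c) \<noteq> {}"
    using theta_some_arc_inside[OF arcs] none ab_c ab_d cd V dist by (simp add: quad_def)
  \<comment> \<open>The path \<open>awb\<close> without its ends is connected and misses the
    triangle, so one point inside brings the middle vertex \<open>w\<close> inside as well.\<close>
  moreover have "w \<in> inside (triangle a b z)"
    if meets: "two_path a w b \<inter> inside (triangle a b z) \<noteq> {}"
      and wz: "{a, b, w, z} \<subseteq> V" "distinct [a, b, w, z]" for w z
  proof -
    obtain x where x: "x \<in> two_path a w b" "x \<in> inside (triangle a b z)"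
      using meets by blast
    have "x \<notin> {a, b}"
      using x vertex_notin_inside_triangle[of a b z x] wz by auto
    moreover have "w \<in> two_path a w b" "w \<noteq> a" "w \<noteq> b"
      using vertex_in_two_path[of a b w w] wz by auto
    moreover have "(two_path a w b - {a, b}) \<inter> triangle a b z = {}"
      using edge_two_path[of a b w] edge_two_path(2)[of a b z] two_path_Int[of a b w z] wz
      by auto
    moreover have "Topological_Spaces.connected (two_path a w b - {a, b})"
      using arc_joining_props(8)[OF two_path_arc[of a b w]] wz by auto
    ultimately show ?thesis
      using connected_meets_inside[of "two_path a w b - {a, b}" "triangle a b z" x w] x by simp
  qed
  ultimately have "c \<in> inside (triangle a b d) \<or> d \<in> inside (triangle a b c)"
    using V dist by auto
  then show False
    using no_vertex_inside_triangle[of a b d c e] no_vertex_inside_triangle[of a b c d e] V dist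
    by auto
qed

text \<open>
  The edges \<open>ab\<close> and \<open>cd\<close> are both chords inside the 4-cycle \<open>acbd\<close>, so they would have to cross.
\<close>
lemma not_five_vertices:
  assumes V: "{a, b, c, d, e} \<subseteq> V" and dist: "distinct [a, b, c, d, e]"
  shows False
proof -
  obtain q where q: "q \<in> E {c, d}" "q \<in> inside (quad a b c d)"
    using edge_inside_quad[of c d a b e] quad_swap[of c d a b] V dist by auto
  have "c \<in> quad a b c d" "d \<in> quad a b c d"
    using vertex_in_two_path[of a b c c] vertex_in_two_path[of a b d d] V dist
    by (auto simp: quad_def)
  then have "q \<noteq> c" "q \<noteq> d"
    using q(2) inside_no_overlap[of "quad a b c d"] by fast+
  have split: "inside (triangle a b c) \<union> inside (triangle a b d) \<union> (E {a, b} - {a, b}) =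
      inside (quad a b c d)"
    using quad_split_by_edge[of a b c d] edge_inside_quad[OF V dist] V dist by auto
  have "E {a, b} \<inter> E {c, d} = {}" using disjoint_edges[of a b c d] V dist by simp
  \<comment> \<open>Following the edge \<open>cd\<close> from \<open>q\<close> now puts
    \<open>d\<close> inside \<open>abc\<close> or \<open>c\<close> inside
    \<open>abd\<close>.\<close>
  then have "q \<in> inside (triangle a b c) \<or> q \<in> inside (triangle a b d)"
    using split q by blast
  then show False
    using vertex_outside_triangle_edge[of a b c d q] vertex_outside_triangle_edge[of a b d c q]
      no_vertex_inside_triangle[of a b c d e] no_vertex_inside_triangle[of a b d c e]
      q \<open>q \<noteq> c\<close> \<open>q \<noteq> d\<close> V dist
    by (auto simp: insert_commute)
qed

end

section \<open>Planar graphs have no five pairwise adjacent vertices\<close>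

lemma planar_no_K5:
  fixes H :: "('a, 'b) pre_digraph"
  assumes "planar H" and W: "W \<subseteq> verts H" "card W = 5"
    and adj: "\<And>x y. \<lbrakk>x \<in> W; y \<in> W; x \<noteq> y\<rbrakk> \<Longrightarrow> (x, y) \<in> arcs_ends H"
  shows False
proof -
  obtain \<phi> :: "'a \<Rightarrow> complex" and \<gamma> where inj: "inj_on \<phi> (verts H)"
    and edge: "\<forall>e \<in> undirected_edges H. Path_Connected.arc (\<gamma> e) \<and>
      {pathstart (\<gamma> e), pathfinish (\<gamma> e)} = \<phi> ` e \<and> path_image (\<gamma> e) \<inter> \<phi> ` verts H = \<phi> ` e"
    and cross: "\<forall>e \<in> undirected_edges H. \<forall>f \<in> undirected_edges H. e \<noteq> f \<longrightarrow>
      path_image (\<gamma> e) \<inter> path_image (\<gamma> f) = \<phi> ` (e \<inter> f)"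
    using assms(1) unfolding planar_def by (elim exE conjE) (rule that)
  \<comment> \<open>The drawing indexes arcs by sets of vertices, the locale by sets of points. The
    preimage is cut down to \<open>W\<close>, since \<open>\<phi>\<close> is injective only on the
    vertices.\<close>
  define E where "E s = path_image (\<gamma> (\<phi> -` s \<inter> W))" for s
  have injW: "inj_on \<phi> W" using inj W(1) by (rule inj_on_subset)
  have E: "E {\<phi> x, \<phi> y} = path_image (\<gamma> {x, y})" if "x \<in> W" "y \<in> W" for x y
  proof -
    have "\<phi> -` {\<phi> x, \<phi> y} \<inter> W = {x, y}" using that injW by (auto dest: inj_onD)
    then show ?thesis by (simp add: E_def)
  qed
  have ue: "{x, y} \<in> undirected_edges H" if "x \<in> W" "y \<in> W" "x \<noteq> y" for x y
    using adj[OF that] unfolding undirected_edges_def by blast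
  interpret complete_plane_drawing "\<phi> ` W" E
  proof
    fix a b assume "a \<in> \<phi> ` W" "b \<in> \<phi> ` W" "a \<noteq> b"
    then obtain x y where ab: "x \<in> W" "y \<in> W" "x \<noteq> y" "a = \<phi> x" "b = \<phi> y" by blast
    note e = edge[rule_format, OF ue[OF ab(1-3)]]
    then have "arc_joining (path_image (\<gamma> {x, y})) (pathstart (\<gamma> {x, y})) (pathfinish (\<gamma> {x, y}))"
      unfolding arc_joining_def by blast
    \<comment> \<open>Planarity fixes only the set of ends of an arc, so it may run in either
      direction.\<close>
    moreover have "pathstart (\<gamma> {x, y}) = a \<and> pathfinish (\<gamma> {x, y}) = b \<or>
        pathstart (\<gamma> {x, y}) = b \<and> pathfinish (\<gamma> {x, y}) = a"
      using e ab by (simp add: doubleton_eq_iff)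
    ultimately show "arc_joining (E {a, b}) a b"
      using arc_joining_sym E[OF ab(1,2)] ab(4,5) by metis
    have "\<phi> ` W \<subseteq> \<phi> ` verts H" using W(1) by blast
    then show "E {a, b} \<inter> \<phi> ` W = {a, b}"
    proof -
      have "path_image (\<gamma> {x, y}) \<inter> \<phi> ` verts H = {a, b}" using e ab(4,5) by simp
      moreover have "{a, b} \<subseteq> \<phi> ` W" using ab by simp
      ultimately show ?thesis
        using \<open>\<phi> ` W \<subseteq> \<phi> ` verts H\<close> E[OF ab(1,2)] ab(4,5) by blast
    qed
    fix c d assume "c \<in> \<phi> ` W" "d \<in> \<phi> ` W" "c \<noteq> d" and ne: "{a, b} \<noteq> {c, d}"
    then obtain z w where cd: "z \<in> W" "w \<in> W" "z \<noteq> w" "c = \<phi> z" "d = \<phi> w" by blast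
    have "{x, y} \<noteq> {z, w}" using ne ab cd by (auto simp: doubleton_eq_iff)
    then have "E {a, b} \<inter> E {c, d} = \<phi> ` ({x, y} \<inter> {z, w})"
      using cross[rule_format, OF ue[OF ab(1-3)] ue[OF cd(1-3)]] E ab cd by simp
    also have "\<dots> = {a, b} \<inter> {c, d}"
      using ab cd injW by (subst inj_on_image_Int[of \<phi> W]) auto
    finally show "E {a, b} \<inter> E {c, d} = {a, b} \<inter> {c, d}" .
  qed
  have "finite W" using W(2) by (intro card_ge_0_finite) simp
  then obtain ws where ws: "set ws = \<phi> ` W" "distinct ws"
    using finite_distinct_list[of "\<phi> ` W"] by auto
  then have "length ws = 5"
    using W(2) card_image[OF injW] distinct_card[of ws] by simp
  then obtain a b c d e where "ws = [a, b, c, d, e]"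
    by (auto simp: numeral_eq_Suc length_Suc_conv)
  then show False using not_five_vertices[of a b c d e] ws by auto
qed

section \<open>Generalized power graphs of p-groups\<close>

context group begin

section \<open>Generators of cyclic subgroups\<close>

text \<open>One subgroup contains the other, both are finite, and coprimality makes the orders of
  \<open>x [^] j\<close> and \<open>x\<close> equal.\<close>

lemma generate_pow_coprime:
  assumes "x \<in> carrier G" "ord x > 0" "coprime j (ord x)"
  shows "generate G {x [^] j} = generate G {x}"
proof (rule card_subset_eq)
  show "finite (generate G {x})"
    using assms generate_pow_card[of x] card_gt_0_iff by metis
  have "x [^] j \<in> generate G {x}"
    using generate_pow_nat[of x] assms by auto
  then show "generate G {x [^] j} \<subseteq> generate G {x}"
    using assms by (intro generate_subgroup_incl generate_is_subgroup) auto
  have "ord (x [^] j) = ord x"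
    using assms ord_pow_gen[of x j] by (auto simp: coprime_iff_gcd_eq_1 gcd.commute)
  then show "card (generate G {x [^] j}) = card (generate G {x})"
    using generate_pow_card assms by simp
qed

lemma generate_eq_of_mem_prime_ord:
  assumes "a \<in> carrier G" "Factorial_Ring.prime (ord a)" "b \<in> generate G {a}" "b \<noteq> \<one>"
  shows "generate G {b} = generate G {a}"
proof -
  have pos: "ord a > 0" using assms(2) prime_gt_0_nat by blast
  then obtain k :: nat where k: "b = a [^] k"
    using generate_pow_nat[of a] assms(1,3) by auto
  then have "\<not> ord a dvd k"
    using assms(1,4) pow_eq_id by blast
  then have "coprime k (ord a)"
    using assms(2) prime_imp_coprime coprime_commute by blast
  then show ?thesis using generate_pow_coprime assms(1) pos k by simp
qed

lemma mem_generate_singleton: "a \<in> generate G {a}"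
  by (simp add: generate.incl)

text \<open>A non-identity element of a group of prime order generates it, so a common one generates
  both subgroups.\<close>

lemma generate_Int_nontrivial_iff:
  assumes "a \<in> carrier G" "b \<in> carrier G" "Factorial_Ring.prime (ord a)" "Factorial_Ring.prime (ord b)"
  shows "generate G {a} \<inter> generate G {b} \<noteq> {\<one>} \<longleftrightarrow> generate G {a} = generate G {b}"
proof
  assume "generate G {a} \<inter> generate G {b} \<noteq> {\<one>}"
  then obtain c where "c \<in> generate G {a}" "c \<in> generate G {b}" "c \<noteq> \<one>"
    using generate.one by blast
  then show "generate G {a} = generate G {b}"
    using generate_eq_of_mem_prime_ord assms by metis
next
  have "a \<noteq> \<one>" using assms(3) by auto
  then show "generate G {a} = generate G {b} \<Longrightarrow> generate G {a} \<inter> generate G {b} \<noteq> {\<one>}"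
    using mem_generate_singleton[of a] by auto
qed

section \<open>Element orders and the exponent\<close>

lemma planar_gen_power_graph_ord:
  assumes "planar (gen_power_graph G)" and x: "x \<in> carrier G" "ord x = p ^ k" and p: "p = 3 \<or> p = 5"
  shows "k \<le> 1"
proof (rule ccontr)
  assume k: "\<not> k \<le> 1"
  \<comment> \<open>exponents below 9 that are prime to both 3 and 5\<close>
  let ?J = "{1, 2, 4, 7, 8 :: nat}"
  have "(9::nat) \<le> p ^ 2" using p by auto
  also have "\<dots> \<le> p ^ k" using k p by (intro power_increasing) auto
  finally have ord: "9 \<le> ord x" using x by simp
  \<comment> \<open>Powers with exponents from 1 to \<open>ord x\<close> are pairwise distinct, and
    9 exceeds every exponent in \<open>?J\<close>.\<close>
  then have inj: "inj_on (\<lambda>j::nat. x [^] j) ?J"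
    by (intro inj_on_subset[OF ord_inj'[OF x(1)]]) auto
  have gen: "generate G {x [^] j} = generate G {x}" if "j \<in> ?J" for j
  proof (rule generate_pow_coprime)
    have "Factorial_Ring.prime p" using p by auto
    moreover have "\<not> p dvd j" using p that by auto
    ultimately have "coprime p j" by (rule prime_imp_coprime)
    then show "coprime j (ord x)" using x(2) by (simp add: coprime_commute)
    show "x \<in> carrier G" "ord x > 0" using x(1) ord by simp_all
  qed
  have ne: "x [^] j \<noteq> \<one>" if "j \<in> ?J" for j
    using that x ord pow_eq_id[OF x(1), of j] by (auto dest: dvd_imp_le)
  show False
  proof (rule planar_no_K5[OF assms(1)])
    show "(\<lambda>j::nat. x [^] j) ` ?J \<subseteq> verts (gen_power_graph G)"
    proof (rule image_subsetI)
      fix j assume "j \<in> ?J"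
      then show "x [^] j \<in> verts (gen_power_graph G)"
        using ne x(1) by (simp add: gen_power_graph_def)
    qed
    show "card ((\<lambda>j::nat. x [^] j) ` ?J) = 5"
      using card_image[OF inj] by simp
    fix a b assume ab: "a \<in> (\<lambda>j::nat. x [^] j) ` ?J" "b \<in> (\<lambda>j::nat. x [^] j) ` ?J" "a \<noteq> b"
    have "generate G {y} = generate G {x} \<and> y \<noteq> \<one> \<and> y \<in> carrier G"
      if y: "y \<in> (\<lambda>j::nat. x [^] j) ` ?J" for y
    proof -
      obtain j where "y = x [^] j" "j \<in> ?J" using y by (rule imageE)
      then show ?thesis using gen ne x(1) by simp
    qed
    \<comment> \<open>The two subgroups coincide, and their intersection contains \<open>a\<close>,
      which is not the identity.\<close>
    from this[OF ab(1)] this[OF ab(2)] show "(a, b) \<in> arcs_ends (gen_power_graph G)"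
      using ab(3) mem_generate_singleton[of a] by (auto simp: gen_power_graph_def)
  qed
qed

lemma planar_p_group_pow:
  assumes "p_group p G" "planar (gen_power_graph G)" "p = 3 \<or> p = 5" and x: "x \<in> carrier G"
  shows "x [^] p = \<one>"
proof -
  obtain k where k: "ord x = p ^ k" using assms(1) x unfolding p_group_def by blast
  then have "k \<le> 1" using planar_gen_power_graph_ord[OF assms(2) x _ assms(3)] by blast
  then have "ord x dvd p" using k by (cases k) auto
  then show ?thesis using pow_eq_id[OF x] by blast
qed

lemma ord_eq_prime:
  assumes "Factorial_Ring.prime p" "x \<in> carrier G" "x \<noteq> \<one>" "x [^] p = \<one>"
  shows "ord x = p"
proof -
  have "ord x dvd p" using assms pow_eq_id by blast
  moreover have "ord x \<noteq> 1" using assms ord_eq_1 by blast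
  ultimately show ?thesis using assms(1) by (auto simp: prime_nat_iff)
qed

text \<open>The element \<open>x\<close> has order exactly \<open>p\<close>, so every annihilating
  exponent is a multiple of \<open>p\<close>. It also excludes the trivial group, whose exponent is
  1.\<close>

lemma group_exponent_prime:
  assumes "Factorial_Ring.prime p" and pow: "\<And>x. x \<in> carrier G \<Longrightarrow> x [^] p = \<one>"
    and "x \<in> carrier G" "x \<noteq> \<one>"
  shows "group_exponent G = p"
proof -
  have "p > 0" using assms(1) prime_gt_0_nat by blast
  moreover have "(LEAST n. n > 0 \<and> (\<forall>x \<in> carrier G. x [^] n = \<one>)) = p"
  proof (rule Least_equality)
    fix n :: nat assume n: "n > 0 \<and> (\<forall>x \<in> carrier G. x [^] n = \<one>)"
    then have "p dvd n" using ord_eq_prime[of p x] pow_eq_id[of x n] assms by auto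
    then show "p \<le> n" using n by (simp add: dvd_imp_le)
  qed (use pow \<open>p > 0\<close> in auto)
  ultimately show ?thesis unfolding group_exponent_def using pow by auto
qed

end

section \<open>Components when all non-identity elements have order p\<close>

lemma sym_digraph_gen_power_graph: "sym_digraph (gen_power_graph G)"
  by unfold_locales
     (auto simp: gen_power_graph_def symmetric_def intro!: symI)

context
  fixes G :: "('a, 'b) monoid_scheme" (structure) and p :: nat
  assumes grp: "group G" and prime: "Factorial_Ring.prime p"
    and ord: "\<And>x. \<lbrakk>x \<in> carrier G; x \<noteq> \<one>\<rbrakk> \<Longrightarrow> group.ord G x = p"
begin

interpretation group G by (rule grp)

interpretation sym_digraph "gen_power_graph G" by (rule sym_digraph_gen_power_graph)

lemma arcs_ends_gen_power_graph_prime: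
  "(a, b) \<in> arcs_ends (gen_power_graph G) \<longleftrightarrow>
    a \<in> carrier G - {\<one>} \<and> b \<in> carrier G - {\<one>} \<and> a \<noteq> b \<and> generate G {a} = generate G {b}"
  using generate_Int_nontrivial_iff[of a b] ord[of a] ord[of b] prime
  by (auto simp: gen_power_graph_def)

lemma generate_subset: "a \<in> carrier G \<Longrightarrow> generate G {a} \<subseteq> carrier G"
  using generate_incl[of "{a}"] by simp

text \<open>Each arc preserves the generated subgroup, hence so does each walk. Conversely, two
  generators of one subgroup are equal or adjacent.\<close>

lemma scc_of_gen_power_graph_prime:
  assumes a: "a \<in> carrier G - {\<one>}"
  shows "pre_digraph.scc_of (gen_power_graph G) a = generate G {a} - {\<one>}"
proof (intro equalityI subsetI)
  fix b assume "b \<in> pre_digraph.scc_of (gen_power_graph G) a"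
  then have "a \<rightarrow>\<^sup>*\<^bsub>gen_power_graph G\<^esub> b" by (simp add: scc_of_def)
  then have "b \<in> carrier G - {\<one>} \<and> generate G {a} = generate G {b}"
    by (induction rule: reachable_induct)
       (use a arcs_ends_gen_power_graph_prime in auto)
  then show "b \<in> generate G {a} - {\<one>}" using mem_generate_singleton[of b] by auto
next
  fix b assume b: "b \<in> generate G {a} - {\<one>}"
  then have "generate G {b} = generate G {a}"
    using generate_eq_of_mem_prime_ord[of a b] ord[of a] prime a by auto
  moreover have "b \<in> carrier G" using generate_subset[of a] a b by auto
  ultimately have "a = b \<or> (a, b) \<in> arcs_ends (gen_power_graph G)"
    using arcs_ends_gen_power_graph_prime a b by auto
  moreover have "a \<in> verts (gen_power_graph G)" using a by (simp add: gen_power_graph_def)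
  ultimately have "a \<rightarrow>\<^sup>*\<^bsub>gen_power_graph G\<^esub> b" by auto
  then show "b \<in> pre_digraph.scc_of (gen_power_graph G) a" by (rule scc_ofI_reachable')
qed

lemma card_generate_minus_one:
  assumes "a \<in> carrier G - {\<one>}"
  shows "finite (generate G {a} - {\<one>})" "card (generate G {a} - {\<one>}) = p - 1"
proof -
  have "card (generate G {a}) = p" using generate_pow_card[of a] ord[of a] assms by simp
  moreover have "p > 0" using prime prime_gt_0_nat by blast
  ultimately show "finite (generate G {a} - {\<one>})" "card (generate G {a} - {\<one>}) = p - 1"
    using generate.one[of G "{a}"] by (simp_all add: card_ge_0_finite card_Diff_singleton)
qed

lemma sccs_verts_gen_power_graph_prime:
  "pre_digraph.sccs_verts (gen_power_graph G) = (\<lambda>a. generate G {a} - {\<one>}) ` (carrier G - {\<one>})"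
proof -
  have "verts (gen_power_graph G) = carrier G - {\<one>}" by (simp add: gen_power_graph_def)
  then show ?thesis
    using sccs_verts_conv_scc_of scc_of_gen_power_graph_prime
    by (auto simp: image_iff)
qed

lemma component_gen_power_graph_prime:
  assumes "H \<in> graph_components (gen_power_graph G)"
  shows "complete_digraph (p - 1) H"
proof -
  obtain a where a: "a \<in> carrier G - {\<one>}"
    and H: "H = gen_power_graph G \<restriction> (generate G {a} - {\<one>})"
    using assms unfolding sccs_conv_sccs_verts sccs_verts_gen_power_graph_prime by blast
  let ?S = "generate G {a} - {\<one>}"
  \<comment> \<open>The component as a pair digraph, the form in which
    \<open>complete_digraph_pair_def\<close> characterizes complete graphs.\<close>
  let ?K = "\<lparr>pverts = ?S, parcs = {(u, v). (u, v) \<in> ?S \<times> ?S \<and> u \<noteq> v}\<rparr>"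
  have S: "b \<in> carrier G - {\<one>}" "generate G {b} = generate G {a}" if b: "b \<in> ?S" for b
  proof -
    have "b \<in> carrier G" using b a generate_subset[of a] by blast
    then show "b \<in> carrier G - {\<one>}" using b by simp
    show "generate G {b} = generate G {a}"
      using generate_eq_of_mem_prime_ord[of a b] ord[of a] prime a b by simp
  qed
  have arcs: "arcs (gen_power_graph G) = arcs_ends (gen_power_graph G)"
    by (simp add: gen_power_graph_def)
  have "e \<in> arcs (gen_power_graph G) \<longleftrightarrow> fst e \<noteq> snd e" if "fst e \<in> ?S" "snd e \<in> ?S" for e
    using arcs_ends_gen_power_graph_prime[of "fst e" "snd e"] S[OF that(1)] S[OF that(2)]
    by (simp add: arcs)
  then have "{e \<in> arcs (gen_power_graph G). fst e \<in> ?S \<and> snd e \<in> ?S} =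
      {(u, v). (u, v) \<in> ?S \<times> ?S \<and> u \<noteq> v}"
    by fastforce
  moreover have "tail (gen_power_graph G) = fst" "head (gen_power_graph G) = snd"
    by (simp_all add: gen_power_graph_def)
  ultimately have "H = with_proj ?K"
    unfolding H induce_subgraph_def with_proj_def by simp
  then show ?thesis
    using card_generate_minus_one[OF a] by (simp add: complete_digraph_pair_def)
qed

text \<open>The components partition the non-identity elements into classes of size
  \<open>p - 1\<close>, so the division is exact.\<close>

lemma card_components_gen_power_graph_prime:
  assumes "finite (carrier G)"
  shows "card (graph_components (gen_power_graph G)) = (Coset.order G - 1) div (p - 1)"
proof -
  let ?C = "pre_digraph.sccs_verts (gen_power_graph G)"
  have Un: "\<Union>?C = carrier G - {\<one>}"
    unfolding sccs_verts_gen_power_graph_prime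
    using generate_subset mem_generate_singleton by blast
  have "(p - 1) * card ?C = card (\<Union>?C)"
  proof (rule card_partition)
    show "finite ?C" using assms by (simp add: sccs_verts_gen_power_graph_prime)
    show "finite (\<Union>?C)" using assms Un by simp
    show "card c = p - 1" if "c \<in> ?C" for c
      using that card_generate_minus_one by (auto simp: sccs_verts_gen_power_graph_prime)
    show "c \<inter> d = {}" if "c \<in> ?C" "d \<in> ?C" "c \<noteq> d" for c d
      using that by (rule sccs_verts_disjoint)
  qed
  also have "\<dots> = Coset.order G - 1"
    using Un assms by (simp add: Coset.order_def card_Diff_singleton)
  finally have "(p - 1) * card ?C = Coset.order G - 1" .
  moreover have "p - 1 > 0" using prime prime_gt_1_nat by simp
  ultimately show ?thesis
    by (metis card_sccs_verts nonzero_mult_div_cancel_left not_less0)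
qed

end

theorem theorem5p1:
  fixes G :: "('a, 'b) monoid_scheme" and p :: nat
  assumes "Factorial_Ring.prime p"
    and "p_group p G"
    and "\<not> comm_group G"
    and "planar (gen_power_graph G)"
    and "p \<in> {3, 5}"
  shows "group_exponent G = p \<and>
    (\<forall>n. Coset.order G = p ^ n \<longrightarrow>
       pre_digraph.Union (gen_power_graph G) (graph_components (gen_power_graph G))
         = gen_power_graph G \<and>
       card (graph_components (gen_power_graph G)) = (p ^ n - 1) div (p - 1) \<and>
       (\<forall>H \<in> graph_components (gen_power_graph G). complete_digraph (p - 1) H))"
proof -
  interpret group G using assms(2) by (simp add: p_group_def)
  have p: "p = 3 \<or> p = 5" using assms(5) by simp
  have pow: "x [^]\<^bsub>G\<^esub> p = \<one>\<^bsub>G\<^esub>" if "x \<in> carrier G" for x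
    using planar_p_group_pow[OF assms(2,4) p that] .
  have ord: "ord x = p" if "x \<in> carrier G" "x \<noteq> \<one>\<^bsub>G\<^esub>" for x
    using ord_eq_prime[OF assms(1) that pow[OF that(1)]] .
  \<comment> \<open>A group whose only element is the identity would be commutative.\<close>
  obtain x where x: "x \<in> carrier G" "x \<noteq> \<one>\<^bsub>G\<^esub>"
    using assms(3) group_comm_groupI by (metis l_one r_one)
  \<comment> \<open>\<open>Coset.order\<close> is 0 for an infinite carrier, while
    \<open>p ^ n\<close> is positive.\<close>
  have fin: "finite (carrier G)" if "Coset.order G = p ^ n" for n
    using that p by (intro card_ge_0_finite) (auto simp: Coset.order_def)
  show ?thesis
  proof (intro conjI allI impI ballI)
    show "group_exponent G = p" using group_exponent_prime[OF assms(1) pow x] .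
    show "pre_digraph.Union (gen_power_graph G) (graph_components (gen_power_graph G))
        = gen_power_graph G"
      using sym_digraph_gen_power_graph by (rule sym_digraph.graph_is_union_sccs)
    show "complete_digraph (p - 1) H" if "H \<in> graph_components (gen_power_graph G)" for H
      using component_gen_power_graph_prime[OF is_group assms(1) ord that] .
    show "card (graph_components (gen_power_graph G)) = (p ^ n - 1) div (p - 1)"
      if n: "Coset.order G = p ^ n" for n
      using card_components_gen_power_graph_prime[OF is_group assms(1) ord fin[OF n]] n by simp
  qed
qed

end
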